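(* Suppose $\alpha_2>0$, and let $u_d=\sum_{w\ge d/2}x_{d,w}$ for integers $d\ge 2$. Then \[ u_d\sim\frac{\Gamma\bigl(1+\tfrac{\beta+1}{\alpha}\bigr)}{\alpha_2\,\Gamma\bigl(1+\tfrac{\beta}{\alpha}\bigr)}\,\Bigl(\frac{\alpha}{\alpha_2}\,d\Bigr)^{-\bigl(1+\tfrac1\alpha\bigr)}\quad\text{as } d\to\infty, \] where $\sim$ means that the ratio of the two sides tends to $1$.
   Context: Parameters $0<p\le 1$, $q,r\in[0,1]$. Constants: $\alpha_1=(1-p)q$, $\alpha_2=\frac{2pr}{3}$, $\alpha=\alpha_1+\alpha_2$, $\beta=2(1-r)+\frac{3(1-p)(1-q)}{p}$. $\Gamma$ is the Gamma function. The numbers $x_{d,w}$ (for integers $w\ge1$, $d$) are defined by $x_{d,w}=0$ unless $2\le d\le 2w$, $x_{2,1}=\frac{1}{\alpha+\beta+1}$, and for $w\ge2$, $2\le d\le 2w$, \[ x_{d,w}=\frac{1}{\alpha w+\beta+1}\bigl[\alpha_1(w-1)x_{d,w-1}+\alpha_2(w-1)x_{d-1,w-1}+\beta x_{d-2,w-1}\bigr]. \] (These are the almost sure limiting proportions of vertices of degree $d$ and weight $w$ in the random graph model with parameters $(p,q,r)$ driven by 3-interactions, and $u_d$ is the limiting proportion of vertices of degree $d$.) *)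

theory Defs
  imports
    "HOL-Analysis.Infinite_Sum"
    "HOL-Analysis.Gamma_Function"
    "HOL-Library.Landau_Symbols"
begin

definition alpha1 :: "real \<Rightarrow> real \<Rightarrow> real" where
  "alpha1 p q = (1 - p) * q"

definition alpha2 :: "real \<Rightarrow> real \<Rightarrow> real" where
  "alpha2 p r = 2 * p * r / 3"

definition alpha :: "real \<Rightarrow> real \<Rightarrow> real \<Rightarrow> real" where
  "alpha p q r = alpha1 p q + alpha2 p r"

definition beta :: "real \<Rightarrow> real \<Rightarrow> real \<Rightarrow> real" where
  "beta p q r = 2 * (1 - r) + 3 * (1 - p) * (1 - q) / p"

text \<open>
  The limiting proportion of vertices of degree \<open>d\<close> and weight \<open>w\<close>. Weights start at 1; the
  value at weight 0 is a dummy that the recursion never uses. In the last equation the weight is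
  \<open>w + 1\<close>, so the factor \<open>w - 1\<close> of the usual recursion appears as \<open>w\<close>; for weight 1 the
  range condition on \<open>d\<close> forces \<open>d = 2\<close>.
\<close>
primrec x_prop :: "real \<Rightarrow> real \<Rightarrow> real \<Rightarrow> int \<Rightarrow> nat \<Rightarrow> real" where
  "x_prop p q r d 0 = 0"
| "x_prop p q r d (Suc w) =
    (if 2 \<le> d \<and> d \<le> 2 * int (Suc w) then
       if w = 0 then 1 / (alpha p q r + beta p q r + 1)
       else (alpha1 p q * real w * x_prop p q r d w
             + alpha2 p r * real w * x_prop p q r (d - 1) w
             + beta p q r * x_prop p q r (d - 2) w)
            / (alpha p q r * real (Suc w) + beta p q r + 1)
     else 0)"

definition u_prop :: "real \<Rightarrow> real \<Rightarrow> real \<Rightarrow> int \<Rightarrow> real" where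
  "u_prop p q r d = (\<Sum>\<^sub>\<infinity>w\<in>{w::nat. real w \<ge> real_of_int d / 2}. x_prop p q r d w)"

end

theory Submission
  imports Defs "HOL-Real_Asymp.Real_Asymp"
begin

text \<open>
  For fixed weight \<open>w\<close>, the numbers \<open>x d w\<close> form, up to their total mass, the law of a sum of
  independent increments: when the weight grows from \<open>w\<close> to \<open>w + 1\<close>, the degree grows by
  0, 1 or 2 with probabilities proportional to \<open>a1 * w\<close>, \<open>a2 * w\<close> and \<open>b\<close>. So the degree
  concentrates around \<open>\<rho> * w\<close> with \<open>\<rho> = a2 / (a1 + a2)\<close>, while the total mass of weight \<open>w\<close>
  is an explicit quotient of rising factorials, of order \<open>w powr (- (1 + 1 / a))\<close> with
  \<open>a = a1 + a2\<close>. Heuristically \<open>u d\<close> is the mass of the weight \<open>d / \<rho>\<close>, divided by \<open>\<rho>\<close>.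

  A local limit theorem would justify the heuristic, but a conservation law makes it superfluous.
  Let \<open>tail d\<close> be the total mass of all pairs whose degree is at least \<open>d\<close>. Summing the
  recursion over these pairs, everything telescopes except what crosses the level, which gives
  the identity \<open>tail (d + 1) = a2 * v d + b * (u d + u (d - 1))\<close> with
  \<open>v d = (\<Sum>w. w * x d w)\<close> (lemma \<open>tail_eq_flux\<close>). Hence sharp asymptotics of the tail, which
  require concentration only on the scale of the weight itself (lemma \<open>tail_asymp\<close>), already
  determine \<open>v d\<close>: the two terms with factor \<open>b\<close> are smaller by a factor \<open>1 / d\<close>. By
  concentration once more, \<open>\<rho> * v d\<close> and \<open>d * u d\<close> are asymptotically equal
  (lemma \<open>weight_degree_difference_negligible\<close>), and \<open>u d\<close> follows.

  The concentration comes from exponential moments (lemma \<open>exponential_moment_bound\<close>): they obey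
  a first-order recursion in \<open>w\<close>, so they grow geometrically at a controlled rate.
\<close>

section \<open>The recursion\<close>

text \<open>
  The assumption \<open>x_outside\<close> makes weight 0 an empty level. All sums over weights can therefore
  start at 0, and a telescoping sum over all weights has no boundary term there.
\<close>

locale degree_weight =
  fixes a1 a2 b :: real and x :: "int \<Rightarrow> nat \<Rightarrow> real"
  assumes a1_nonneg: "0 \<le> a1" and a2_pos: "0 < a2" and b_nonneg: "0 \<le> b"
    and x_outside: "\<not> (2 \<le> d \<and> d \<le> 2 * int w) \<Longrightarrow> x d w = 0"
    and x_start: "x 2 1 = 1 / (a1 + a2 + b + 1)"
    and x_rec: "\<lbrakk>1 \<le> w; 2 \<le> d; d \<le> 2 * int (Suc w)\<rbrakk> \<Longrightarrow>
      x d (Suc w) = (a1 * real w * x d w + a2 * real w * x (d - 1) w + b * x (d - 2) w)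
        / ((a1 + a2) * real (Suc w) + b + 1)"
begin

definition a :: real where "a = a1 + a2"
definition \<rho> :: real where "\<rho> = a2 / a"

lemma a_pos: "0 < a"
  using a1_nonneg a2_pos by (simp add: a_def)

lemma \<rho>_pos: "0 < \<rho>" and \<rho>_le_1: "\<rho> \<le> 1" and a_\<rho>: "a * \<rho> = a2"
  using a1_nonneg a2_pos by (auto simp: \<rho>_def a_def)

lemma x_weight_0 [simp]: "x d 0 = 0"
  by (rule x_outside) auto

lemma denominator_pos: "0 < a * real w + b + 1"
  using a_pos b_nonneg by (smt (verit) mult_nonneg_nonneg of_nat_0_le_iff)

lemma x_step:
  assumes "1 \<le> w"
  shows "(a * real (Suc w) + b + 1) * x d (Suc w)
       = a1 * real w * x d w + a2 * real w * x (d - 1) w + b * x (d - 2) w"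
proof (cases "2 \<le> d \<and> d \<le> 2 * int (Suc w)")
  case True
  then show ?thesis
    using x_rec[OF assms, of d] denominator_pos[of "Suc w"] by (simp add: a_def field_simps)
next
  case False
  then have "x d (Suc w) = 0" "x d w = 0" "x (d - 1) w = 0" "x (d - 2) w = 0"
    by (auto intro!: x_outside)
  then show ?thesis by simp
qed

lemma x_nonneg: "0 \<le> x d w"
proof (induction w arbitrary: d)
  case (Suc w)
  consider "w = 0" "d = 2" | "w = 0" "d \<noteq> 2" | "1 \<le> w" by linarith
  then show ?case
  proof cases
    case 1
    then show ?thesis using x_start a_pos b_nonneg by (simp add: a_def)
  next
    case 2
    then have "x d (Suc w) = 0" by (intro x_outside) auto
    then show ?thesis by simp
  next
    case 3
    have "0 \<le> (a * real (Suc w) + b + 1) * x d (Suc w)"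
      unfolding x_step[OF 3] using Suc a1_nonneg a2_pos b_nonneg by simp
    then show ?thesis using denominator_pos[of "Suc w"] by (simp add: zero_le_mult_iff)
  qed
qed simp

definition wsum :: "(int \<Rightarrow> real) \<Rightarrow> nat \<Rightarrow> real" where
  "wsum g w = (\<Sum>e\<in>{2..2 * int w}. g e * x e w)"

lemma wsum_shift:
  assumes "0 \<le> k" "k \<le> 2"
  shows "(\<Sum>e\<in>{2..2 * int (Suc w)}. g e * x (e - k) w) = wsum (\<lambda>e. g (e + k)) w"
proof -
  have "(\<Sum>e\<in>{2..2 * int (Suc w)}. g e * x (e - k) w)
      = (\<Sum>e\<in>{2 - k..2 * int (Suc w) - k}. g (e + k) * x e w)"
    by (rule sum.reindex_bij_witness[of _ "\<lambda>e. e + k" "\<lambda>e. e - k"]) auto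
  also have "\<dots> = wsum (\<lambda>e. g (e + k)) w"
    unfolding wsum_def
    by (rule sum.mono_neutral_right) (use assms in \<open>auto intro!: x_outside\<close>)
  finally show ?thesis .
qed

text \<open>
  The recursion read forwards: the mass at degree \<open>e\<close> is sent on to the degrees \<open>e\<close>, \<open>e + 1\<close> and
  \<open>e + 2\<close>. The total mass, the exponential moments and the mass above a level all
  follow from it by choosing \<open>g\<close>.
\<close>

lemma wsum_step:
  assumes "1 \<le> w"
  shows "(a * real (Suc w) + b + 1) * wsum g (Suc w)
       = wsum (\<lambda>e. a1 * real w * g e + a2 * real w * g (e + 1) + b * g (e + 2)) w"
proof -
  let ?A = "{2..2 * int (Suc w)}"
  have "(a * real (Suc w) + b + 1) * wsum g (Suc w)
      = (\<Sum>e\<in>?A. g e * ((a * real (Suc w) + b + 1) * x e (Suc w)))"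
    unfolding wsum_def sum_distrib_left by (simp add: mult_ac)
  also have "\<dots> = a1 * real w * (\<Sum>e\<in>?A. g e * x (e - 0) w)
      + a2 * real w * (\<Sum>e\<in>?A. g e * x (e - 1) w) + b * (\<Sum>e\<in>?A. g e * x (e - 2) w)"
    unfolding x_step[OF assms] sum_distrib_left sum.distrib[symmetric]
    by (intro sum.cong refl) (simp add: algebra_simps)
  also have "\<dots> = a1 * real w * wsum g w + a2 * real w * wsum (\<lambda>e. g (e + 1)) w
      + b * wsum (\<lambda>e. g (e + 2)) w"
    by (subst (1 2 3) wsum_shift) auto
  also have "\<dots> = wsum (\<lambda>e. a1 * real w * g e + a2 * real w * g (e + 1) + b * g (e + 2)) w"
    unfolding wsum_def sum_distrib_left sum.distrib[symmetric]
    by (intro sum.cong refl) (simp add: algebra_simps)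
  finally show ?thesis .
qed

lemma wsum_0 [simp]: "wsum g 0 = 0"
  by (simp add: wsum_def)

lemma wsum_nonneg: "(\<And>e. 0 \<le> g e) \<Longrightarrow> 0 \<le> wsum g w"
  unfolding wsum_def by (intro sum_nonneg mult_nonneg_nonneg x_nonneg)

lemma wsum_mono: "(\<And>e. g e \<le> h e) \<Longrightarrow> wsum g w \<le> wsum h w"
  unfolding wsum_def by (intro sum_mono mult_right_mono x_nonneg)

lemma wsum_ge_term:
  assumes "\<And>e. 0 \<le> g e"
  shows "g d * x d w \<le> wsum g w"
proof (cases "d \<in> {2..2 * int w}")
  case True
  then show ?thesis
    unfolding wsum_def
    by (intro member_le_sum[of d _ "\<lambda>e. g e * x e w"]) (auto intro!: mult_nonneg_nonneg x_nonneg assms)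
next
  case False
  then have "x d w = 0" by (intro x_outside) auto
  then show ?thesis using wsum_nonneg[OF assms] by simp
qed

section \<open>The total mass of each weight\<close>

definition mass :: "nat \<Rightarrow> real" where "mass = wsum (\<lambda>_. 1)"

text \<open>
  The total mass of all weights greater than \<open>n\<close>, as lemma \<open>mass_beyond_sums\<close> shows. The closed
  form exists because the recursion for \<open>mass\<close> says that \<open>(a * w + b) * mass w\<close> decreases exactly
  by \<open>mass (w + 1)\<close> when \<open>w\<close> increases by one.
\<close>

definition mass_beyond :: "nat \<Rightarrow> real" where
  "mass_beyond n = pochhammer (1 + b / a) n / pochhammer (1 + (b + 1) / a) n"

lemma mass_nonneg: "0 \<le> mass w"
  unfolding mass_def by (rule wsum_nonneg) simp

lemma mass_0 [simp]: "mass 0 = 0"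
  by (simp add: mass_def)

lemma mass_step: "1 \<le> w \<Longrightarrow> (a * real (Suc w) + b + 1) * mass (Suc w) = (a * real w + b) * mass w"
  unfolding mass_def by (subst wsum_step) (simp_all add: wsum_def a_def sum_distrib_left algebra_simps)

lemma mass_beyond_0: "mass_beyond 0 = 1"
  by (simp add: mass_beyond_def)

lemma mass_beyond_Suc:
  "(a * real (Suc n) + b + 1) * mass_beyond (Suc n) = (a * real (Suc n) + b) * mass_beyond n"
proof -
  have "1 + b / a + real n = (a * real (Suc n) + b) / a"
    "1 + (b + 1) / a + real n = (a * real (Suc n) + b + 1) / a"
    using a_pos by (simp_all add: field_simps)
  then have "mass_beyond (Suc n)
      = mass_beyond n * ((a * real (Suc n) + b) / (a * real (Suc n) + b + 1))"
    unfolding mass_beyond_def pochhammer_Suc using a_pos by simp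
  then show ?thesis
    using denominator_pos[of "Suc n"] by (simp del: of_nat_Suc)
qed

lemma mass_beyond_eq: "1 \<le> w \<Longrightarrow> mass_beyond w = (a * real w + b) * mass w"
proof (induction w rule: dec_induct)
  case base
  have mass_1: "mass 1 = 1 / (a + b + 1)"
    using x_start by (simp add: mass_def wsum_def a_def)
  have "0 < a + b + 1" using a_pos b_nonneg by simp
  moreover have "(a + b + 1) * mass_beyond 1 = a + b"
    using mass_beyond_Suc[of 0] by (simp add: mass_beyond_0)
  ultimately show ?case by (simp add: mass_1 nonzero_eq_divide_eq mult_ac del: One_nat_def)
next
  case (step n)
  have "(a * real (Suc n) + b + 1) * mass_beyond (Suc n)
      = (a * real (Suc n) + b) * ((a * real (Suc n) + b + 1) * mass (Suc n))"
    unfolding mass_beyond_Suc step mass_step[OF step(1)] ..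
  then show ?case using denominator_pos[of "Suc n"] by simp
qed

lemma mass_eq_diff: "mass (Suc n) = mass_beyond n - mass_beyond (Suc n)"
proof -
  have "(a * real (Suc n) + b) * (mass_beyond n - mass_beyond (Suc n)) = mass_beyond (Suc n)"
    using mass_beyond_Suc[of n] by (simp add: algebra_simps)
  also have "\<dots> = (a * real (Suc n) + b) * mass (Suc n)"
    by (rule mass_beyond_eq) simp
  finally have "(a * real (Suc n) + b) * (mass_beyond n - mass_beyond (Suc n))
      = (a * real (Suc n) + b) * mass (Suc n)" .
  moreover have "0 < a * real (Suc n) + b"
    using a_pos b_nonneg by (intro add_pos_nonneg mult_pos_pos) auto
  ultimately show ?thesis by simp
qed

abbreviation gamma_ratio :: real where
  "gamma_ratio \<equiv> Gamma (1 + (b + 1) / a) / Gamma (1 + b / a)"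

lemma gamma_ratio_pos: "0 < gamma_ratio"
  using a_pos b_nonneg by (intro divide_pos_pos Gamma_real_pos) (simp_all add: add_pos_nonneg)

text \<open>
  Each rising factorial is the denominator of a term of Euler's limit formula for the Gamma
  function; in the quotient the factorials cancel and the powers of \<open>n\<close> leave the
  exponent \<open>- (1 / a)\<close>.
\<close>

lemma mass_beyond_asymp: "(\<lambda>n. mass_beyond n * real n powr (1 / a)) \<longlonglongrightarrow> gamma_ratio"
proof (rule LIMSEQ_imp_Suc)
  define s where "s = 1 + b / a"
  define t where "t = 1 + (b + 1) / a"
  have pos: "0 < s" "0 < t" using a_pos b_nonneg by (simp_all add: s_def t_def add_pos_nonneg)
  have st: "t - s = 1 / a" by (simp add: s_def t_def add_divide_distrib)
  have "(\<lambda>n. Gamma_series t n / Gamma_series s n) \<longlonglongrightarrow> Gamma t / Gamma s"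
    using Gamma_real_pos[OF pos(1)] by (intro tendsto_intros) auto
  moreover have "(\<lambda>n. (real (Suc n) / real n) powr (1 / a)) \<longlonglongrightarrow> 1"
    using a_pos by real_asymp
  ultimately have "(\<lambda>n. Gamma_series t n / Gamma_series s n * (real (Suc n) / real n) powr (1 / a))
      \<longlonglongrightarrow> Gamma t / Gamma s * 1"
    by (rule tendsto_mult)
  moreover have "eventually (\<lambda>n. Gamma_series t n / Gamma_series s n * (real (Suc n) / real n) powr (1 / a)
      = mass_beyond (Suc n) * real (Suc n) powr (1 / a)) sequentially"
  proof (rule eventually_sequentiallyI[of 1])
    fix n :: nat assume "1 \<le> n"
    then have "exp (t * ln (real n)) = exp (s * ln (real n)) * real n powr (1 / a)"
      by (simp add: powr_def st[symmetric] exp_add[symmetric] algebra_simps)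
    moreover have "pochhammer s (Suc n) > 0" "pochhammer t (Suc n) > 0"
      using pos by (auto intro: pochhammer_pos)
    ultimately show "Gamma_series t n / Gamma_series s n * (real (Suc n) / real n) powr (1 / a)
      = mass_beyond (Suc n) * real (Suc n) powr (1 / a)"
      using \<open>1 \<le> n\<close>
      unfolding Gamma_series_def mass_beyond_def s_def[symmetric] t_def[symmetric]
      by (simp add: powr_divide field_simps del: of_nat_Suc)
  qed
  ultimately show "(\<lambda>n. mass_beyond (Suc n) * real (Suc n) powr (1 / a)) \<longlonglongrightarrow> gamma_ratio"
    by (simp add: s_def t_def Lim_transform_eventually)
qed

lemma mass_beyond_tendsto_0: "mass_beyond \<longlonglongrightarrow> 0"
proof -
  have "(\<lambda>n. real n powr (- (1 / a))) \<longlonglongrightarrow> 0" using a_pos by real_asymp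
  from tendsto_mult[OF mass_beyond_asymp this]
  have "(\<lambda>n. mass_beyond n * real n powr (1 / a) * real n powr (- (1 / a))) \<longlonglongrightarrow> 0" by simp
  then show ?thesis
  proof (rule Lim_transform_eventually)
    show "eventually (\<lambda>n. mass_beyond n * real n powr (1 / a) * real n powr (- (1 / a))
        = mass_beyond n) sequentially"
      by (rule eventually_sequentiallyI[of 1]) (simp add: powr_minus field_simps)
  qed
qed

lemma mass_beyond_sums: "(\<lambda>w. if n < w then mass w else 0) sums mass_beyond n"
proof -
  have "(\<lambda>i. mass_beyond (i + n) - mass_beyond (Suc i + n)) sums (mass_beyond (0 + n) - 0)"
    by (rule telescope_sums'[of "\<lambda>i. mass_beyond (i + n)"])
      (rule LIMSEQ_ignore_initial_segment[OF mass_beyond_tendsto_0])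
  then have "(\<lambda>i. if n < i + Suc n then mass (i + Suc n) else 0) sums mass_beyond n"
    by (simp add: mass_eq_diff)
  then show ?thesis by (subst (asm) sums_zero_iff_shift) auto
qed

lemma summable_mass: "summable mass"
proof -
  have "(\<lambda>w. if 0 < w then mass w else 0) = mass" by auto
  then show ?thesis using mass_beyond_sums[of 0] by (auto simp: sums_iff)
qed

lemma mass_beyond_scaled:
  assumes "0 < c"
  shows "((\<lambda>d::int. mass_beyond (nat \<lfloor>real_of_int d / c\<rfloor>) * real_of_int d powr (1 / a))
    \<longlongrightarrow> gamma_ratio * c powr (1 / a)) at_top"
proof -
  define N where "N = (\<lambda>y::real. nat \<lfloor>y / c\<rfloor>)"
  have "filterlim N at_top at_top" unfolding N_def using assms by real_asymp
  note lim = filterlim_compose[OF mass_beyond_asymp this]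
  have "((\<lambda>y. (y / (real_of_int \<lfloor>y / c\<rfloor>)) powr (1 / a)) \<longlongrightarrow> c powr (1 / a)) at_top"
    using assms a_pos by real_asymp
  note tendsto_mult[OF lim this]
  moreover have "eventually (\<lambda>y. mass_beyond (N y) * real (N y) powr (1 / a)
      * (y / (real_of_int \<lfloor>y / c\<rfloor>)) powr (1 / a) = mass_beyond (N y) * y powr (1 / a)) at_top"
    using eventually_ge_at_top[of c]
  proof eventually_elim
    case (elim y)
    then have "1 \<le> \<lfloor>y / c\<rfloor>" "0 < y" using assms by (auto simp: le_floor_iff)
    then have "0 < N y" "real_of_int \<lfloor>y / c\<rfloor> = real (N y)" by (simp_all add: N_def)
    with \<open>0 < y\<close> show ?case by (simp add: powr_divide)
  qed
  ultimately have "((\<lambda>y. mass_beyond (N y) * y powr (1 / a)) \<longlongrightarrow> gamma_ratio * c powr (1 / a)) at_top"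
    by (rule Lim_transform_eventually)
  from filterlim_compose[OF this filterlim_real_of_int_at_top] show ?thesis by (simp add: N_def)
qed

section \<open>Concentration of the degree around a multiple of the weight\<close>

lemma exp_le_quadratic:
  fixes \<theta> :: real
  assumes "\<bar>\<theta>\<bar> \<le> 1"
  shows "exp \<theta> \<le> 1 + \<theta> + \<theta>\<^sup>2"
proof (cases "0 \<le> \<theta>")
  case True
  then show ?thesis using assms by (intro exp_bound) auto
next
  case False
  define y where "y = - \<theta>"
  have y: "0 < y" using False by (simp add: y_def)
  have "1 + y \<le> exp y" by (rule exp_ge_add_one_self)
  then have "exp \<theta> * (1 + y) \<le> 1"
    by (simp add: y_def exp_minus field_simps)
  also have "1 \<le> (1 - y + y\<^sup>2) * (1 + y)"
    using y by (simp add: power2_eq_square algebra_simps)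
  finally show ?thesis using y by (simp add: y_def)
qed

lemma eventually_ratio_le_imp_geometric_bound:
  fixes f :: "nat \<Rightarrow> real"
  assumes "0 < A" and step: "\<And>n. n0 \<le> n \<Longrightarrow> f (Suc n) \<le> A * f n"
  obtains C where "0 < C" "\<And>n. f n \<le> C * A ^ n"
proof
  define C where "C = 1 + (\<Sum>n\<le>n0. \<bar>f n\<bar> / A ^ n)"
  show "0 < C" unfolding C_def using assms(1) by (intro add_pos_nonneg sum_nonneg) auto
  have small: "f n \<le> C * A ^ n" if "n \<le> n0" for n
  proof -
    have "\<bar>f n\<bar> / A ^ n \<le> (\<Sum>n\<le>n0. \<bar>f n\<bar> / A ^ n)"
      using that assms(1) by (intro member_le_sum) auto
    then have "\<bar>f n\<bar> / A ^ n \<le> C" by (simp add: C_def)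
    then show ?thesis using assms(1) by (simp add: field_simps)
  qed
  show "f n \<le> C * A ^ n" for n
  proof (cases "n \<le> n0")
    case False
    then have "n0 \<le> n" by simp
    then show ?thesis
    proof (induction n rule: dec_induct)
      case (step n)
      have "f (Suc n) \<le> A * f n" using step by (intro assms)
      also have "\<dots> \<le> A * (C * A ^ n)" using step assms(1) by (intro mult_left_mono) auto
      finally show ?case by (simp add: mult_ac)
    qed (simp add: small)
  qed (simp add: small)
qed

text \<open>
  The exponential moment \<open>G w\<close> gains the factor \<open>1 + \<rho> * (exp \<theta> - 1) + O(1 / w)\<close> per step. Since
  \<open>exp \<theta> - 1 \<le> \<theta> + \<theta>\<^sup>2\<close>, the doubled quadratic term in the rate leaves room to absorb the
  \<open>O(1 / w)\<close> from some weight on; the earlier weights only affect the constant.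
\<close>

lemma exponential_moment_bound:
  assumes "\<theta> \<noteq> 0" "\<bar>\<theta>\<bar> \<le> 1"
  obtains C where "0 < C" "\<And>d w. x d w \<le> C * exp (\<theta> * (\<rho> * real w - real_of_int d) + 2 * \<rho> * \<theta>\<^sup>2 * real w)"
proof -
  define A where "A = exp (\<rho> * (\<theta> + 2 * \<theta>\<^sup>2))"
  define G where "G = wsum (\<lambda>e. exp (\<theta> * real_of_int e))"
  \<comment> \<open>From this weight on, the surplus \<open>a2 * \<theta>\<^sup>2 * w\<close> of the rate covers the term with factor \<open>b\<close>.\<close>
  obtain n0 :: nat where n0: "b * exp (2 * \<theta>) / (a2 * \<theta>\<^sup>2) \<le> real n0"
    using real_arch_simple by blast
  have G_step: "G (Suc n) \<le> A * G n" if n: "Suc n0 \<le> n" for n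
  proof -
    have "b * exp (2 * \<theta>) / (a2 * \<theta>\<^sup>2) \<le> real n" using n0 n by simp
    then have lead: "b * exp (2 * \<theta>) \<le> a2 * \<theta>\<^sup>2 * real n"
      using a2_pos assms(1) by (simp add: field_simps)
    have "(a * real (Suc n) + b + 1) * G (Suc n)
        = wsum (\<lambda>e. a1 * real n * exp (\<theta> * e) + a2 * real n * exp (\<theta> * (e + 1)) + b * exp (\<theta> * (e + 2))) n"
      unfolding G_def using n by (subst wsum_step) auto
    also have "\<dots> = ((a1 + a2 * exp \<theta>) * real n + b * exp (2 * \<theta>)) * G n"
      unfolding G_def wsum_def sum_distrib_left
      by (intro sum.cong refl) (simp add: algebra_simps exp_add)
    also have "\<dots> \<le> (a * real (Suc n) + b + 1) * A * G n"
    proof (rule mult_right_mono)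
      have "a2 * exp \<theta> \<le> a2 * (1 + \<theta> + \<theta>\<^sup>2)"
        using exp_le_quadratic[OF assms(2)] a2_pos by (intro mult_left_mono) auto
      then have bound: "(a1 + a2 * exp \<theta>) * real n \<le> (a + a2 * (\<theta> + \<theta>\<^sup>2)) * real n"
        by (intro mult_right_mono) (simp_all add: a_def algebra_simps)
      have "(a1 + a2 * exp \<theta>) * real n + b * exp (2 * \<theta>)
          \<le> a * real n * (1 + \<rho> * (\<theta> + 2 * \<theta>\<^sup>2))"
      proof -
        have "a * real n * (1 + \<rho> * (\<theta> + 2 * \<theta>\<^sup>2))
            = a * real n + (a * \<rho>) * (\<theta> + 2 * \<theta>\<^sup>2) * real n"
          by (simp add: algebra_simps)
        with bound lead show ?thesis unfolding a_\<rho> by (simp add: algebra_simps)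
      qed
      also have "\<dots> \<le> a * real n * A"
        unfolding A_def using a_pos by (intro mult_left_mono exp_ge_add_one_self) auto
      also have "\<dots> \<le> (a * real (Suc n) + b + 1) * A"
        using a_pos b_nonneg by (intro mult_right_mono) (auto simp: A_def algebra_simps)
      finally show "(a1 + a2 * exp \<theta>) * real n + b * exp (2 * \<theta>) \<le> (a * real (Suc n) + b + 1) * A" .
      show "0 \<le> G n" unfolding G_def by (rule wsum_nonneg) simp
    qed
    finally show ?thesis using denominator_pos[of "Suc n"] by (simp add: mult.assoc)
  qed
  obtain C where C: "0 < C" "\<And>n. G n \<le> C * A ^ n"
    by (rule eventually_ratio_le_imp_geometric_bound[of A "Suc n0" G, OF _ G_step]) (auto simp: A_def)
  have "x d w \<le> C * exp (\<theta> * (\<rho> * real w - real_of_int d) + 2 * \<rho> * \<theta>\<^sup>2 * real w)" for d w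
  proof -
    have "exp (\<theta> * real_of_int d) * x d w \<le> G w"
      unfolding G_def by (rule wsum_ge_term) simp
    also have "\<dots> \<le> C * A ^ w" by (rule C)
    also have "A ^ w = exp (real w * (\<rho> * (\<theta> + 2 * \<theta>\<^sup>2)))"
      unfolding A_def by (rule exp_of_nat_mult[symmetric])
    also have "real w * (\<rho> * (\<theta> + 2 * \<theta>\<^sup>2)) = \<theta> * real_of_int d
        + (\<theta> * (\<rho> * real w - real_of_int d) + 2 * \<rho> * \<theta>\<^sup>2 * real w)"
      by (simp add: algebra_simps)
    finally show ?thesis unfolding exp_add by simp
  qed
  with C(1) show thesis by (rule that)
qed

text \<open>
  Chernoff's argument: the sign of \<open>\<theta>\<close> is chosen against the deviation, and \<open>\<bar>\<theta>\<bar>\<close> so small that the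
  quadratic term costs at most half of the linear gain \<open>\<bar>\<theta>\<bar> * \<epsilon> * w\<close>.
\<close>

lemma large_deviation_bound:
  assumes "0 < \<epsilon>"
  obtains C \<kappa> where "0 < C" "0 < \<kappa>"
    "\<And>d w. \<epsilon> * real w \<le> \<bar>\<rho> * real w - real_of_int d\<bar> \<Longrightarrow> x d w \<le> C * exp (- \<kappa> * real w)"
proof -
  define \<theta> where "\<theta> = min 1 (\<epsilon> / (4 * \<rho>))"
  have \<theta>: "0 < \<theta>" "\<theta> \<le> 1" "\<theta> \<le> \<epsilon> / (4 * \<rho>)" using assms \<rho>_pos by (auto simp: \<theta>_def)
  then have \<rho>\<theta>: "2 * \<rho> * \<theta> \<le> \<epsilon> / 2" using \<rho>_pos by (simp add: field_simps)
  obtain C1 where C1: "0 < C1" "\<And>d w. x d w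
      \<le> C1 * exp (\<theta> * (\<rho> * real w - real_of_int d) + 2 * \<rho> * \<theta>\<^sup>2 * real w)"
    using exponential_moment_bound[of \<theta>] \<theta> by auto
  obtain C2 where C2: "0 < C2" "\<And>d w. x d w
      \<le> C2 * exp ((- \<theta>) * (\<rho> * real w - real_of_int d) + 2 * \<rho> * (- \<theta>)\<^sup>2 * real w)"
    by (rule exponential_moment_bound[of "- \<theta>"]) (use \<theta> in auto)
  show thesis
  proof (rule that[of "max C1 C2" "\<theta> * \<epsilon> / 2"])
    show "0 < max C1 C2" using C1(1) by simp
    show "0 < \<theta> * \<epsilon> / 2" using \<theta> assms by simp
    fix d w
    assume far: "\<epsilon> * real w \<le> \<bar>\<rho> * real w - real_of_int d\<bar>"
    define m where "m = \<rho> * real w - real_of_int d"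
    have "2 * \<rho> * \<theta> * (\<theta> * real w) \<le> \<epsilon> / 2 * (\<theta> * real w)"
      using \<rho>\<theta> \<theta>(1) by (intro mult_right_mono) auto
    moreover have "\<theta> * (\<epsilon> * real w) \<le> \<theta> * \<bar>m\<bar>"
      using far \<theta>(1) unfolding m_def by (intro mult_left_mono) auto
    ultimately have ex: "- \<theta> * \<bar>m\<bar> + 2 * \<rho> * \<theta>\<^sup>2 * real w \<le> - (\<theta> * \<epsilon> / 2) * real w"
      by (simp add: power2_eq_square algebra_simps)
    have "x d w \<le> max C1 C2 * exp (- \<theta> * \<bar>m\<bar> + 2 * \<rho> * \<theta>\<^sup>2 * real w)"
    proof (cases "m \<le> 0")
      case True
      then have "\<theta> * m = - \<theta> * \<bar>m\<bar>" by simp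
      with C1(2)[of d w, folded m_def] have "x d w \<le> C1 * exp (- \<theta> * \<bar>m\<bar> + 2 * \<rho> * \<theta>\<^sup>2 * real w)"
        by (simp only: power2_minus)
      also have "\<dots> \<le> max C1 C2 * exp (- \<theta> * \<bar>m\<bar> + 2 * \<rho> * \<theta>\<^sup>2 * real w)"
        by (intro mult_right_mono) auto
      finally show ?thesis .
    next
      case False
      then have "(- \<theta>) * m = - \<theta> * \<bar>m\<bar>" by simp
      with C2(2)[of d w, folded m_def] have "x d w \<le> C2 * exp (- \<theta> * \<bar>m\<bar> + 2 * \<rho> * \<theta>\<^sup>2 * real w)"
        by (simp only: power2_minus)
      also have "\<dots> \<le> max C1 C2 * exp (- \<theta> * \<bar>m\<bar> + 2 * \<rho> * \<theta>\<^sup>2 * real w)"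
        by (intro mult_right_mono) auto
      finally show ?thesis .
    qed
    also have "\<dots> \<le> max C1 C2 * exp (- (\<theta> * \<epsilon> / 2) * real w)"
      using ex C1(1) by (intro mult_left_mono) auto
    finally show "x d w \<le> max C1 C2 * exp (- (\<theta> * \<epsilon> / 2) * real w)" .
  qed
qed

section \<open>The mass above a given degree\<close>

definition mass_above :: "int \<Rightarrow> nat \<Rightarrow> real" where
  "mass_above d = wsum (\<lambda>e. of_bool (d \<le> e))"

definition tail :: "int \<Rightarrow> real" where "tail d = (\<Sum>w. mass_above d w)"
definition u :: "int \<Rightarrow> real" where "u d = (\<Sum>w. x d w)"
definition v :: "int \<Rightarrow> real" where "v d = (\<Sum>w. real w * x d w)"

lemma mass_above_nonneg: "0 \<le> mass_above d w"
  unfolding mass_above_def by (rule wsum_nonneg) simp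

lemma mass_above_le_mass: "mass_above d w \<le> mass w"
  unfolding mass_above_def mass_def by (rule wsum_mono) simp

lemma mass_above_0 [simp]: "mass_above d 0 = 0"
  by (simp add: mass_above_def)

lemma mass_above_eq_0: "2 * int w < d \<Longrightarrow> mass_above d w = 0"
  unfolding mass_above_def wsum_def by (rule sum.neutral) auto

lemma summable_mass_above: "summable (mass_above d)"
  by (rule summable_comparison_test'[OF summable_mass, of 0])
    (simp add: mass_above_le_mass mass_above_nonneg)

lemma x_le_mass: "x d w \<le> mass w"
  using wsum_ge_term[of "\<lambda>_. 1" d w] by (simp add: mass_def)

lemma summable_x: "summable (x d)"
  by (rule summable_comparison_test'[OF summable_mass, of 0]) (simp add: x_le_mass x_nonneg)

lemma wsum_single: "wsum (\<lambda>e. of_bool (e = d)) w = x d w"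
proof -
  have "wsum (\<lambda>e. of_bool (e = d)) w = (\<Sum>e\<in>{2..2 * int w}. if e = d then x e w else 0)"
    unfolding wsum_def by (intro sum.cong refl) simp
  also have "\<dots> = x d w"
    using x_outside[of d w] by (auto simp: sum.delta)
  finally show ?thesis .
qed

text \<open>
  Besides the mass that is already at degree at least \<open>d\<close>, weight \<open>w + 1\<close> receives above the level
  only what jumps from \<open>d - 1\<close> (by one or by two) and from \<open>d - 2\<close> (by two). For smaller \<open>d\<close> the
  initial mass at degree 2 would contribute as well.
\<close>

lemma mass_above_step:
  assumes "3 \<le> d"
  shows "(a * real (Suc w) + b + 1) * mass_above d (Suc w) = (a * real w + b) * mass_above d w
    + (a2 * real w * x (d - 1) w + b * (x (d - 1) w + x (d - 2) w))"
proof (cases "w = 0")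
  case True
  then show ?thesis using assms by (simp add: mass_above_eq_0)
next
  case False
  have "(a * real (Suc w) + b + 1) * mass_above d (Suc w)
      = wsum (\<lambda>e. a1 * real w * of_bool (d \<le> e) + a2 * real w * of_bool (d \<le> e + 1)
          + b * of_bool (d \<le> e + 2)) w"
    unfolding mass_above_def using False by (subst wsum_step) auto
  also have "\<dots> = wsum (\<lambda>e. (a * real w + b) * of_bool (d \<le> e)
      + ((a2 * real w + b) * of_bool (e = d - 1) + b * of_bool (e = d - 2))) w"
    unfolding wsum_def by (intro sum.cong refl) (auto simp: a_def algebra_simps)
  also have "\<dots> = (a * real w + b) * mass_above d w
      + ((a2 * real w + b) * wsum (\<lambda>e. of_bool (e = d - 1)) w + b * wsum (\<lambda>e. of_bool (e = d - 2)) w)"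
    unfolding mass_above_def wsum_def sum_distrib_left sum.distrib[symmetric]
    by (intro sum.cong refl) (simp add: algebra_simps)
  finally show ?thesis unfolding wsum_single by (simp add: algebra_simps)
qed

text \<open>
  The terms of \<open>mass_above_step\<close> other than the flux telescope, and the boundary term
  \<open>(a * w + b) * mass_above (d + 1) w\<close> vanishes in the limit because it is at most
  \<open>mass_beyond w\<close>.
\<close>

lemma flux_sums:
  assumes "2 \<le> d"
  shows "(\<lambda>w. a2 * real w * x d w + b * (x d w + x (d - 1) w)) sums tail (d + 1)"
proof -
  define h where "h w = (a * real w + b) * mass_above (d + 1) w" for w
  have "h \<longlonglongrightarrow> 0"
  proof (rule tendsto_sandwich[OF _ _ tendsto_const mass_beyond_tendsto_0])
    show "eventually (\<lambda>w. 0 \<le> h w) sequentially"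
      using a_pos b_nonneg by (auto simp: h_def mass_above_nonneg)
    show "eventually (\<lambda>w. h w \<le> mass_beyond w) sequentially"
      using a_pos b_nonneg
      by (intro eventually_sequentiallyI[of 1])
        (auto simp: h_def mass_beyond_eq intro!: mult_left_mono mass_above_le_mass)
  qed
  then have "(\<lambda>w. h w - h (Suc w)) sums (h 0 - 0)" by (rule telescope_sums')
  moreover have "(\<lambda>w. mass_above (d + 1) (Suc w)) sums tail (d + 1)"
    using summable_sums[OF summable_mass_above[of "d + 1"]] by (simp add: sums_Suc_iff tail_def)
  ultimately have "(\<lambda>w. mass_above (d + 1) (Suc w) - (h w - h (Suc w))) sums (tail (d + 1) - (h 0 - 0))"
    by (rule sums_diff[rotated])
  moreover have "mass_above (d + 1) (Suc w) - (h w - h (Suc w))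
      = a2 * real w * x d w + b * (x d w + x (d - 1) w)" for w
    using mass_above_step[of "d + 1" w] assms by (simp add: h_def algebra_simps)
  ultimately show ?thesis by (simp add: h_def)
qed

lemma summable_weighted_x:
  assumes "2 \<le> d"
  shows "summable (\<lambda>w. real w * x d w)"
proof (rule summable_comparison_test'[of "\<lambda>w. (a2 * real w * x d w + b * (x d w + x (d - 1) w)) / a2" 0])
  show "summable (\<lambda>w. (a2 * real w * x d w + b * (x d w + x (d - 1) w)) / a2)"
    using flux_sums[OF assms] by (intro summable_divide) (auto simp: sums_iff)
  show "norm (real w * x d w) \<le> (a2 * real w * x d w + b * (x d w + x (d - 1) w)) / a2" for w
    using a2_pos b_nonneg x_nonneg[of d w] x_nonneg[of "d - 1" w] by (simp add: field_simps)
qed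

lemma tail_eq_flux:
  assumes "2 \<le> d"
  shows "tail (d + 1) = a2 * v d + b * (u d + u (d - 1))"
proof -
  have "(\<lambda>w. a2 * (real w * x d w) + b * (x d w + x (d - 1) w)) sums (a2 * v d + b * (u d + u (d - 1)))"
    unfolding v_def u_def
    by (intro sums_add sums_mult summable_sums summable_x summable_weighted_x assms)
  with flux_sums[OF assms] show ?thesis by (simp add: mult.assoc sums_unique2)
qed

lemma u_nonneg: "0 \<le> u d"
  unfolding u_def by (intro suminf_nonneg summable_x x_nonneg)

lemma degree_u_le_v:
  assumes "2 \<le> d"
  shows "real_of_int d * u d \<le> 2 * v d"
proof -
  have "(\<Sum>w. real_of_int d * x d w) \<le> (\<Sum>w. 2 * (real w * x d w))"
  proof (rule suminf_le)
    show "real_of_int d * x d w \<le> 2 * (real w * x d w)" for w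
    proof (cases "d \<le> 2 * int w")
      case True
      then have "real_of_int d \<le> 2 * real w" by linarith
      then have "real_of_int d * x d w \<le> 2 * real w * x d w" by (intro mult_right_mono x_nonneg)
      then show ?thesis by simp
    qed (simp add: x_outside)
  qed (intro summable_mult summable_x summable_weighted_x assms)+
  then show ?thesis
    unfolding u_def v_def using summable_x summable_weighted_x[OF assms] by (simp add: suminf_mult)
qed

text \<open>
  An a priori bound of the right order, up to a constant. It shows that the terms with
  factor \<open>b\<close> in \<open>tail_eq_flux\<close> are negligible.
\<close>

lemma u_le_tail:
  assumes "2 \<le> d"
  shows "u d \<le> 2 / a2 * tail (d + 1) * (1 / real_of_int d)"
proof -
  have "a2 * v d \<le> tail (d + 1)"
    using tail_eq_flux[OF assms] b_nonneg u_nonneg by simp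
  moreover have "a2 * (real_of_int d * u d) \<le> a2 * (2 * v d)"
    using degree_u_le_v[OF assms] a2_pos by (intro mult_left_mono) auto
  ultimately have "a2 * (real_of_int d * u d) \<le> 2 * tail (d + 1)" by simp
  then show ?thesis using assms a2_pos by (simp add: field_simps)
qed

section \<open>Asymptotics of the tail\<close>

text \<open>
  The decay in the weight is shared out: one part absorbs the factor \<open>w\<close>, one becomes decay in the
  degree \<open>d\<close>, and one remains as a geometric sequence that can be summed over \<open>w\<close>.
\<close>

lemma weight_exp_bound:
  assumes "0 < \<kappa>" "d \<le> 2 * int w"
  shows "real w * exp (- \<kappa> * real w) \<le> 4 / \<kappa> * exp (- (\<kappa> / 4) * real_of_int d) * exp (- (\<kappa> / 4)) ^ w"
proof -
  have "\<kappa> / 4 * real w \<le> exp (\<kappa> / 4 * real w)"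
    using exp_ge_add_one_self[of "\<kappa> / 4 * real w"] by linarith
  then have "real w \<le> 4 / \<kappa> * exp (\<kappa> / 4 * real w)" using assms(1) by (simp add: field_simps)
  then have "real w * exp (- \<kappa> * real w) \<le> 4 / \<kappa> * exp (\<kappa> / 4 * real w) * exp (- \<kappa> * real w)"
    by (intro mult_right_mono) auto
  also have "\<dots> = 4 / \<kappa> * exp (\<kappa> / 4 * real w + - \<kappa> * real w)"
    unfolding exp_add by simp
  also have "\<kappa> / 4 * real w + - \<kappa> * real w = - (\<kappa> / 4) * (2 * real w) + real w * (- (\<kappa> / 4))"
    by (simp add: field_simps)
  also have "exp \<dots> = exp (- (\<kappa> / 4) * (2 * real w)) * exp (- (\<kappa> / 4)) ^ w"
    unfolding exp_add by (simp only: exp_of_nat_mult)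
  also have "4 / \<kappa> * \<dots> \<le> 4 / \<kappa> * (exp (- (\<kappa> / 4) * real_of_int d) * exp (- (\<kappa> / 4)) ^ w)"
  proof (intro mult_left_mono mult_right_mono)
    have "real_of_int d \<le> 2 * real w" using assms(2) by linarith
    then show "exp (- (\<kappa> / 4) * (2 * real w)) \<le> exp (- (\<kappa> / 4) * real_of_int d)"
      using assms(1) by simp
  qed (use assms in auto)
  finally show ?thesis by (simp add: mult.assoc)
qed

text \<open>
  The form in which the large deviation bound is applied: pairs whose degree is far from
  \<open>\<rho> * w\<close> contribute, summed over \<open>w\<close>, only an amount exponentially small in \<open>d\<close>. Allowing the
  second statement an arbitrary set \<open>P\<close> of far degrees serves both the degrees above and the
  degrees below the level \<open>d\<close>.
\<close>

lemma far_sum_bound: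
  assumes "0 < \<epsilon>"
  obtains C \<kappa> q where "0 < C" "0 < \<kappa>" "0 < q" "q < 1"
    "\<And>d w. \<lbrakk>d \<le> 2 * int w; \<epsilon> * real w \<le> \<bar>\<rho> * real w - real_of_int d\<bar>\<rbrakk>
      \<Longrightarrow> real w * x d w \<le> C * exp (- \<kappa> * real_of_int d) * q ^ w"
    "\<And>P d w. \<lbrakk>d \<le> 2 * int w; \<And>e. P e \<Longrightarrow> \<epsilon> * real w \<le> \<bar>\<rho> * real w - real_of_int e\<bar>\<rbrakk>
      \<Longrightarrow> wsum (\<lambda>e. of_bool (P e)) w \<le> C * exp (- \<kappa> * real_of_int d) * q ^ w"
proof -
  obtain C \<kappa> where C: "0 < C" "0 < \<kappa>"
    and dev: "\<And>d w. \<epsilon> * real w \<le> \<bar>\<rho> * real w - real_of_int d\<bar> \<Longrightarrow> x d w \<le> C * exp (- \<kappa> * real w)"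
    using large_deviation_bound[OF assms] by blast
  have bound: "2 * real w * (C * exp (- \<kappa> * real w))
      \<le> 8 * C / \<kappa> * exp (- (\<kappa> / 4) * real_of_int d) * exp (- (\<kappa> / 4)) ^ w"
    if "d \<le> 2 * int w" for d w
    using mult_left_mono[OF weight_exp_bound[OF C(2) that], of "2 * C"] C(1) by (simp add: mult_ac)
  show thesis
  proof (rule that[of "8 * C / \<kappa>" "\<kappa> / 4" "exp (- (\<kappa> / 4))"])
    fix d w
    assume d: "d \<le> 2 * int w" and far: "\<epsilon> * real w \<le> \<bar>\<rho> * real w - real_of_int d\<bar>"
    have "real w * x d w \<le> real w * (C * exp (- \<kappa> * real w))"
      by (intro mult_left_mono dev far) auto
    also have "\<dots> \<le> 2 * real w * (C * exp (- \<kappa> * real w))"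
      using C by (intro mult_right_mono) auto
    also note bound[OF d]
    finally show "real w * x d w \<le> 8 * C / \<kappa> * exp (- (\<kappa> / 4) * real_of_int d) * exp (- (\<kappa> / 4)) ^ w" .
  next
    fix P d w
    assume d: "d \<le> 2 * int w" and far: "\<And>e. P e \<Longrightarrow> \<epsilon> * real w \<le> \<bar>\<rho> * real w - real_of_int e\<bar>"
    have "wsum (\<lambda>e. of_bool (P e)) w \<le> (\<Sum>e\<in>{2..2 * int w}. C * exp (- \<kappa> * real w))"
      unfolding wsum_def using C dev far by (intro sum_mono) auto
    also have "\<dots> = real (nat (2 * int w - 1)) * (C * exp (- \<kappa> * real w))" by simp
    also have "\<dots> \<le> 2 * real w * (C * exp (- \<kappa> * real w))"
      using C by (intro mult_right_mono) auto
    also note bound[OF d]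
    finally show "wsum (\<lambda>e. of_bool (P e)) w
      \<le> 8 * C / \<kappa> * exp (- (\<kappa> / 4) * real_of_int d) * exp (- (\<kappa> / 4)) ^ w" .
  qed (use C in auto)
qed

text \<open>
  Weights up to \<open>d / (\<rho> + \<epsilon>)\<close> reach the degree \<open>d\<close> only by a large deviation.
\<close>

lemma tail_le_mass_beyond:
  assumes "0 < \<epsilon>"
  obtains C \<kappa> where "0 < \<kappa>" "\<And>d. 0 \<le> d \<Longrightarrow>
    tail d \<le> mass_beyond (nat \<lfloor>real_of_int d / (\<rho> + \<epsilon>)\<rfloor>) + C * exp (- \<kappa> * real_of_int d)"
proof -
  obtain C \<kappa> q where C: "0 < C" "0 < \<kappa>" "0 < q" "q < 1"
    and far: "\<And>P d w. \<lbrakk>d \<le> 2 * int w; \<And>e. P e \<Longrightarrow> \<epsilon> * real w \<le> \<bar>\<rho> * real w - real_of_int e\<bar>\<rbrakk>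
      \<Longrightarrow> wsum (\<lambda>e. of_bool (P e)) w \<le> C * exp (- \<kappa> * real_of_int d) * q ^ w"
    by (rule far_sum_bound[OF assms]) blast
  have "tail d \<le> mass_beyond (nat \<lfloor>real_of_int d / (\<rho> + \<epsilon>)\<rfloor>)
      + C * exp (- \<kappa> * real_of_int d) * (1 / (1 - q))" if "0 \<le> d" for d
  proof (rule sums_le)
    let ?N = "nat \<lfloor>real_of_int d / (\<rho> + \<epsilon>)\<rfloor>"
    show "mass_above d sums tail d"
      unfolding tail_def by (intro summable_sums summable_mass_above)
    show "(\<lambda>w. (if ?N < w then mass w else 0) + C * exp (- \<kappa> * real_of_int d) * q ^ w)
        sums (mass_beyond ?N + C * exp (- \<kappa> * real_of_int d) * (1 / (1 - q)))"
      using C by (intro sums_add mass_beyond_sums sums_mult geometric_sums) auto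
    show "mass_above d w \<le> (if ?N < w then mass w else 0) + C * exp (- \<kappa> * real_of_int d) * q ^ w" for w
    proof -
      have err: "0 \<le> C * exp (- \<kappa> * real_of_int d) * q ^ w" using C by simp
      consider "2 * int w < d" | "?N < w" | "d \<le> 2 * int w" "w \<le> ?N" by linarith
      then show ?thesis
      proof cases
        case 1
        then show ?thesis using err mass_nonneg[of w] by (simp add: mass_above_eq_0)
      next
        case 2
        then show ?thesis using err mass_above_le_mass[of d w] by simp
      next
        case 3
        have "0 \<le> \<lfloor>real_of_int d / (\<rho> + \<epsilon>)\<rfloor>" using assms \<rho>_pos that by simp
        with 3 have "int w \<le> \<lfloor>real_of_int d / (\<rho> + \<epsilon>)\<rfloor>" by linarith
        then have "real w \<le> real_of_int d / (\<rho> + \<epsilon>)" by (simp add: le_floor_iff)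
        then have "(\<rho> + \<epsilon>) * real w \<le> real_of_int d"
          using assms \<rho>_pos by (simp add: pos_le_divide_eq mult.commute)
        then have "mass_above d w \<le> C * exp (- \<kappa> * real_of_int d) * q ^ w"
          unfolding mass_above_def
        proof (intro far 3)
          fix e assume low: "(\<rho> + \<epsilon>) * real w \<le> real_of_int d" and "d \<le> e"
          then have "real_of_int d \<le> real_of_int e" by simp
          with low show "\<epsilon> * real w \<le> \<bar>\<rho> * real w - real_of_int e\<bar>"
            by (simp add: distrib_right)
        qed
        then show ?thesis using 3 by simp
      qed
    qed
  qed
  then show thesis
    using that[of \<kappa> "C * (1 / (1 - q))"] C(2) by (simp add: mult_ac)
qed

text \<open>
  Weights beyond \<open>d / (\<rho> - \<epsilon>)\<close> stay below the degree \<open>d\<close> only by a large deviation.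
\<close>

lemma tail_ge_mass_beyond:
  assumes "0 < \<epsilon>" "\<epsilon> < \<rho>"
  obtains C \<kappa> where "0 < \<kappa>" "\<And>d. 0 \<le> d \<Longrightarrow>
    mass_beyond (nat \<lfloor>real_of_int d / (\<rho> - \<epsilon>)\<rfloor>) \<le> tail d + C * exp (- \<kappa> * real_of_int d)"
proof -
  obtain C \<kappa> q where C: "0 < C" "0 < \<kappa>" "0 < q" "q < 1"
    and far: "\<And>P d w. \<lbrakk>d \<le> 2 * int w; \<And>e. P e \<Longrightarrow> \<epsilon> * real w \<le> \<bar>\<rho> * real w - real_of_int e\<bar>\<rbrakk>
      \<Longrightarrow> wsum (\<lambda>e. of_bool (P e)) w \<le> C * exp (- \<kappa> * real_of_int d) * q ^ w"
    by (rule far_sum_bound[OF assms(1)]) blast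
  have "mass_beyond (nat \<lfloor>real_of_int d / (\<rho> - \<epsilon>)\<rfloor>)
      \<le> tail d + C * exp (- \<kappa> * real_of_int d) * (1 / (1 - q))" if "0 \<le> d" for d
  proof (rule sums_le)
    let ?N = "nat \<lfloor>real_of_int d / (\<rho> - \<epsilon>)\<rfloor>"
    show "(\<lambda>w. if ?N < w then mass w else 0) sums mass_beyond ?N"
      by (rule mass_beyond_sums)
    show "(\<lambda>w. mass_above d w + C * exp (- \<kappa> * real_of_int d) * q ^ w)
        sums (tail d + C * exp (- \<kappa> * real_of_int d) * (1 / (1 - q)))"
      unfolding tail_def
      using C by (intro sums_add summable_sums summable_mass_above sums_mult geometric_sums) auto
    show "(if ?N < w then mass w else 0) \<le> mass_above d w + C * exp (- \<kappa> * real_of_int d) * q ^ w" for w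
    proof (cases "?N < w")
      case True
      then have "\<lfloor>real_of_int d / (\<rho> - \<epsilon>)\<rfloor> < int w" by linarith
      then have "real_of_int d / (\<rho> - \<epsilon>) < real w" by (simp add: floor_less_iff)
      then have d: "real_of_int d < (\<rho> - \<epsilon>) * real w"
        using assms by (simp add: pos_divide_less_eq mult.commute)
      \<comment> \<open>Because of \<open>\<rho> \<le> 1\<close>, weights this large lie in the range \<open>d \<le> 2 * w\<close> of the far bound.\<close>
      also have "\<dots> \<le> 1 * real w" using assms \<rho>_le_1 by (intro mult_right_mono) auto
      finally have "d \<le> 2 * int w" by linarith
      then have "wsum (\<lambda>e. of_bool (e < d)) w \<le> C * exp (- \<kappa> * real_of_int d) * q ^ w"
      proof (rule far)
        fix e assume "e < d"
        then have "real_of_int e < real_of_int d" by simp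
        with d show "\<epsilon> * real w \<le> \<bar>\<rho> * real w - real_of_int e\<bar>" by (simp add: algebra_simps)
      qed
      moreover have "mass w = mass_above d w + wsum (\<lambda>e. of_bool (e < d)) w"
        unfolding mass_def mass_above_def wsum_def sum.distrib[symmetric] by (intro sum.cong refl) auto
      ultimately show ?thesis using True by simp
    next
      case False
      then show ?thesis using C mass_above_nonneg[of d w] by simp
    qed
  qed
  then show thesis
    using that[of \<kappa> "C * (1 / (1 - q))"] C(2) by (simp add: mult_ac)
qed

lemma exp_times_powr_tendsto_0:
  assumes "0 < \<kappa>"
  shows "((\<lambda>d::int. C * exp (- \<kappa> * real_of_int d) * real_of_int d powr c) \<longlongrightarrow> 0) at_top"
proof -
  have "((\<lambda>y::real. C * exp (- \<kappa> * y) * y powr c) \<longlongrightarrow> 0) at_top"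
    using assms by real_asymp
  from filterlim_compose[OF this filterlim_real_of_int_at_top] show ?thesis .
qed

text \<open>
  After scaling, the two bounds converge to the same expression with \<open>\<rho> + \<epsilon>\<close> and \<open>\<rho> - \<epsilon>\<close> in
  place of \<open>\<rho>\<close>, and this expression is continuous.
\<close>

lemma tail_asymp:
  "((\<lambda>d. tail d * real_of_int d powr (1 / a)) \<longlongrightarrow> gamma_ratio * \<rho> powr (1 / a)) at_top"
proof (rule order_tendstoI)
  fix y assume y: "gamma_ratio * \<rho> powr (1 / a) < y"
  have "((\<lambda>\<epsilon>. gamma_ratio * (\<rho> + \<epsilon>) powr (1 / a)) \<longlongrightarrow> gamma_ratio * (\<rho> + 0) powr (1 / a)) (at_right 0)"
    using \<rho>_pos by (intro tendsto_intros) auto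
  then have "eventually (\<lambda>\<epsilon>. gamma_ratio * (\<rho> + \<epsilon>) powr (1 / a) < y) (at_right 0)"
    using y by (intro order_tendstoD) auto
  then have "eventually (\<lambda>\<epsilon>. 0 < \<epsilon> \<and> gamma_ratio * (\<rho> + \<epsilon>) powr (1 / a) < y) (at_right 0)"
    using eventually_at_right_less[of 0] by eventually_elim simp
  then obtain \<epsilon> where \<epsilon>: "0 < \<epsilon>" "gamma_ratio * (\<rho> + \<epsilon>) powr (1 / a) < y"
    using eventually_happens[of _ "at_right (0::real)"] by force
  obtain C \<kappa> where \<kappa>: "0 < \<kappa>" and le: "\<And>d. 0 \<le> d \<Longrightarrow>
      tail d \<le> mass_beyond (nat \<lfloor>real_of_int d / (\<rho> + \<epsilon>)\<rfloor>) + C * exp (- \<kappa> * real_of_int d)"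
    by (rule tail_le_mass_beyond[OF \<epsilon>(1)]) blast
  have "0 < \<rho> + \<epsilon>" using \<epsilon> \<rho>_pos by simp
  from tendsto_add[OF mass_beyond_scaled[OF this] exp_times_powr_tendsto_0[OF \<kappa>, of C "1 / a"]]
  have "eventually (\<lambda>d. mass_beyond (nat \<lfloor>real_of_int d / (\<rho> + \<epsilon>)\<rfloor>) * real_of_int d powr (1 / a)
      + C * exp (- \<kappa> * real_of_int d) * real_of_int d powr (1 / a) < y) at_top"
    using \<epsilon> by (intro order_tendstoD) auto
  then show "eventually (\<lambda>d. tail d * real_of_int d powr (1 / a) < y) at_top"
    using eventually_ge_at_top[of 0]
  proof eventually_elim
    case (elim d)
    have "tail d * real_of_int d powr (1 / a)
        \<le> (mass_beyond (nat \<lfloor>real_of_int d / (\<rho> + \<epsilon>)\<rfloor>) + C * exp (- \<kappa> * real_of_int d)) * real_of_int d powr (1 / a)"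
      by (intro mult_right_mono le elim) simp
    with elim show ?case by (simp add: distrib_right)
  qed
next
  fix y assume y: "y < gamma_ratio * \<rho> powr (1 / a)"
  have "((\<lambda>\<epsilon>. gamma_ratio * (\<rho> - \<epsilon>) powr (1 / a)) \<longlongrightarrow> gamma_ratio * (\<rho> - 0) powr (1 / a)) (at_right 0)"
    using \<rho>_pos by (intro tendsto_intros) auto
  then have "eventually (\<lambda>\<epsilon>. y < gamma_ratio * (\<rho> - \<epsilon>) powr (1 / a)) (at_right 0)"
    using y by (intro order_tendstoD) auto
  moreover have "eventually (\<lambda>\<epsilon>. 0 < \<epsilon> \<and> \<epsilon> < \<rho>) (at_right 0)"
    using eventually_at_right_real[OF \<rho>_pos] by simp
  ultimately have "eventually (\<lambda>\<epsilon>. 0 < \<epsilon> \<and> \<epsilon> < \<rho> \<and> y < gamma_ratio * (\<rho> - \<epsilon>) powr (1 / a)) (at_right 0)"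
    by eventually_elim simp
  then obtain \<epsilon> where \<epsilon>: "0 < \<epsilon>" "\<epsilon> < \<rho>" "y < gamma_ratio * (\<rho> - \<epsilon>) powr (1 / a)"
    using eventually_happens[of _ "at_right (0::real)"] by force
  obtain C \<kappa> where \<kappa>: "0 < \<kappa>" and ge: "\<And>d. 0 \<le> d \<Longrightarrow>
      mass_beyond (nat \<lfloor>real_of_int d / (\<rho> - \<epsilon>)\<rfloor>) \<le> tail d + C * exp (- \<kappa> * real_of_int d)"
    by (rule tail_ge_mass_beyond[OF \<epsilon>(1,2)]) blast
  have "0 < \<rho> - \<epsilon>" using \<epsilon> by simp
  from tendsto_diff[OF mass_beyond_scaled[OF this] exp_times_powr_tendsto_0[OF \<kappa>, of C "1 / a"]]
  have "eventually (\<lambda>d. y < mass_beyond (nat \<lfloor>real_of_int d / (\<rho> - \<epsilon>)\<rfloor>) * real_of_int d powr (1 / a)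
      - C * exp (- \<kappa> * real_of_int d) * real_of_int d powr (1 / a)) at_top"
    using \<epsilon> by (intro order_tendstoD) auto
  then show "eventually (\<lambda>d. y < tail d * real_of_int d powr (1 / a)) at_top"
    using eventually_ge_at_top[of 0]
  proof eventually_elim
    case (elim d)
    have "mass_beyond (nat \<lfloor>real_of_int d / (\<rho> - \<epsilon>)\<rfloor>) * real_of_int d powr (1 / a)
        \<le> (tail d + C * exp (- \<kappa> * real_of_int d)) * real_of_int d powr (1 / a)"
      by (intro mult_right_mono ge elim) simp
    with elim show ?case by (simp add: distrib_right)
  qed
qed

section \<open>From the tail to the individual terms\<close>

lemma tail_shift_asymp:
  "((\<lambda>d. tail (d + 1) * real_of_int d powr (1 / a)) \<longlongrightarrow> gamma_ratio * \<rho> powr (1 / a)) at_top"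
proof -
  have "filterlim (\<lambda>d::int. d + 1) at_top at_top"
    by (rule filterlim_at_top_mono[OF filterlim_ident]) auto
  note lim = filterlim_compose[OF tail_asymp this]
  have "((\<lambda>y::real. (y / (y + 1)) powr (1 / a)) \<longlongrightarrow> 1) at_top"
    using a_pos by real_asymp
  from tendsto_mult[OF lim filterlim_compose[OF this filterlim_real_of_int_at_top]]
  have "((\<lambda>d. tail (d + 1) * real_of_int (d + 1) powr (1 / a)
      * (real_of_int d / (real_of_int d + 1)) powr (1 / a)) \<longlongrightarrow> gamma_ratio * \<rho> powr (1 / a)) at_top"
    by simp
  then show ?thesis
  proof (rule Lim_transform_eventually)
    show "eventually (\<lambda>d. tail (d + 1) * real_of_int (d + 1) powr (1 / a)
        * (real_of_int d / (real_of_int d + 1)) powr (1 / a)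
        = tail (d + 1) * real_of_int d powr (1 / a)) at_top"
      using eventually_ge_at_top[of 0] by eventually_elim (auto simp: powr_divide)
  qed
qed

lemma u_negligible: "((\<lambda>d. u d * real_of_int d powr (1 / a)) \<longlongrightarrow> 0) at_top"
proof (rule tendsto_sandwich[OF _ _ tendsto_const])
  have "((\<lambda>y::real. 1 / y) \<longlongrightarrow> 0) at_top" by real_asymp
  note inv = filterlim_compose[OF this filterlim_real_of_int_at_top]
  from tendsto_mult[OF tendsto_mult[OF tendsto_const[of "2 / a2"] tail_shift_asymp] inv]
  show "((\<lambda>d. 2 / a2 * (tail (d + 1) * real_of_int d powr (1 / a)) * (1 / real_of_int d)) \<longlongrightarrow> 0) at_top"
    by simp
  show "eventually (\<lambda>d. 0 \<le> u d * real_of_int d powr (1 / a)) at_top"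
    by (simp add: u_nonneg)
  show "eventually (\<lambda>d. u d * real_of_int d powr (1 / a)
      \<le> 2 / a2 * (tail (d + 1) * real_of_int d powr (1 / a)) * (1 / real_of_int d)) at_top"
    using eventually_ge_at_top[of 2]
  proof eventually_elim
    case (elim d)
    show ?case
      using mult_right_mono[OF u_le_tail[OF elim], of "real_of_int d powr (1 / a)"] by (simp add: mult_ac)
  qed
qed

lemma u_pred_negligible: "((\<lambda>d. u (d - 1) * real_of_int d powr (1 / a)) \<longlongrightarrow> 0) at_top"
proof -
  have "filterlim (\<lambda>d::int. d - 1) at_top at_top"
    unfolding filterlim_at_top
  proof
    fix Z :: int
    show "eventually (\<lambda>d. Z \<le> d - 1) at_top"
      using eventually_ge_at_top[of "Z + 1"] by eventually_elim simp
  qed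
  note lim = filterlim_compose[OF u_negligible this]
  have "((\<lambda>y::real. (y / (y - 1)) powr (1 / a)) \<longlongrightarrow> 1) at_top"
    using a_pos by real_asymp
  from tendsto_mult[OF lim filterlim_compose[OF this filterlim_real_of_int_at_top]]
  have "((\<lambda>d. u (d - 1) * real_of_int (d - 1) powr (1 / a)
      * (real_of_int d / (real_of_int d - 1)) powr (1 / a)) \<longlongrightarrow> 0) at_top"
    by simp
  then show ?thesis
  proof (rule Lim_transform_eventually)
    show "eventually (\<lambda>d. u (d - 1) * real_of_int (d - 1) powr (1 / a)
        * (real_of_int d / (real_of_int d - 1)) powr (1 / a)
        = u (d - 1) * real_of_int d powr (1 / a)) at_top"
      using eventually_ge_at_top[of 2] by eventually_elim (auto simp: powr_divide)
  qed
qed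

text \<open>
  The flux identity solved for \<open>v\<close>.
\<close>

lemma v_asymp:
  "((\<lambda>d. v d * real_of_int d powr (1 / a)) \<longlongrightarrow> gamma_ratio * \<rho> powr (1 / a) / a2) at_top"
proof -
  let ?L = "gamma_ratio * \<rho> powr (1 / a)"
  have "((\<lambda>d. (tail (d + 1) * real_of_int d powr (1 / a)
      - b * (u d * real_of_int d powr (1 / a) + u (d - 1) * real_of_int d powr (1 / a))) / a2)
      \<longlongrightarrow> (?L - b * (0 + 0)) / a2) at_top"
    using a2_pos by (intro tendsto_intros tail_shift_asymp u_negligible u_pred_negligible) auto
  then have "((\<lambda>d. (tail (d + 1) * real_of_int d powr (1 / a)
      - b * (u d * real_of_int d powr (1 / a) + u (d - 1) * real_of_int d powr (1 / a))) / a2)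
      \<longlongrightarrow> ?L / a2) at_top" by simp
  then show ?thesis
  proof (rule Lim_transform_eventually)
    show "eventually (\<lambda>d. (tail (d + 1) * real_of_int d powr (1 / a)
        - b * (u d * real_of_int d powr (1 / a) + u (d - 1) * real_of_int d powr (1 / a))) / a2
        = v d * real_of_int d powr (1 / a)) at_top"
      using eventually_ge_at_top[of 2]
    proof eventually_elim
      case (elim d)
      have "(tail (d + 1) * real_of_int d powr (1 / a)
          - b * (u d * real_of_int d powr (1 / a) + u (d - 1) * real_of_int d powr (1 / a)))
          = a2 * (v d * real_of_int d powr (1 / a))"
        unfolding tail_eq_flux[OF elim] by (simp add: algebra_simps)
      then show ?case using a2_pos by simp
    qed
  qed
qed

text \<open>
  Every term of \<open>\<rho> * v d - d * u d\<close> is \<open>(\<rho> * w - d) * x d w\<close>: either \<open>\<bar>\<rho> * w - d\<bar> \<le> \<epsilon> * w\<close>, or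
  \<open>d\<close> is a large deviation at weight \<open>w\<close>.
\<close>

lemma weight_degree_comparison:
  assumes "0 < \<epsilon>"
  obtains C \<kappa> where "0 < \<kappa>" "\<And>d. 2 \<le> d \<Longrightarrow>
    \<bar>\<rho> * v d - real_of_int d * u d\<bar> \<le> \<epsilon> * v d + C * exp (- \<kappa> * real_of_int d)"
proof -
  obtain C \<kappa> q where C: "0 < C" "0 < \<kappa>" "0 < q" "q < 1"
    and far: "\<And>d w. \<lbrakk>d \<le> 2 * int w; \<epsilon> * real w \<le> \<bar>\<rho> * real w - real_of_int d\<bar>\<rbrakk>
      \<Longrightarrow> real w * x d w \<le> C * exp (- \<kappa> * real_of_int d) * q ^ w"
    by (rule far_sum_bound[OF assms]) blast
  have "\<bar>\<rho> * v d - real_of_int d * u d\<bar>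
      \<le> \<epsilon> * v d + 2 * C * exp (- \<kappa> * real_of_int d) * (1 / (1 - q))" if d: "2 \<le> d" for d
  proof -
    define g where "g w = \<rho> * (real w * x d w) - real_of_int d * x d w" for w
    define h where "h w = \<epsilon> * (real w * x d w) + 2 * C * exp (- \<kappa> * real_of_int d) * q ^ w" for w
    have g: "g sums (\<rho> * v d - real_of_int d * u d)"
      unfolding g_def v_def u_def
      by (intro sums_diff sums_mult summable_sums summable_x summable_weighted_x d)
    have h: "h sums (\<epsilon> * v d + 2 * C * exp (- \<kappa> * real_of_int d) * (1 / (1 - q)))"
      unfolding h_def v_def using C
      by (intro sums_add sums_mult summable_sums summable_weighted_x d geometric_sums) auto
    have gh: "\<bar>g w\<bar> \<le> h w" for w
    proof -
      have "g w = (\<rho> * real w - real_of_int d) * x d w"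
        by (simp add: g_def algebra_simps)
      then have g_eq: "\<bar>g w\<bar> = \<bar>\<rho> * real w - real_of_int d\<bar> * x d w"
        using x_nonneg[of d w] by (simp add: abs_mult)
      have err: "0 \<le> 2 * C * exp (- \<kappa> * real_of_int d) * q ^ w" using C by simp
      have main: "0 \<le> \<epsilon> * (real w * x d w)" using assms x_nonneg by simp
      consider "2 * int w < d" | "\<bar>\<rho> * real w - real_of_int d\<bar> \<le> \<epsilon> * real w"
        | "d \<le> 2 * int w" "\<epsilon> * real w \<le> \<bar>\<rho> * real w - real_of_int d\<bar>" by linarith
      then show ?thesis
      proof cases
        case 1
        then show ?thesis using err main by (simp add: g_eq h_def x_outside)
      next
        case 2
        then have "\<bar>g w\<bar> \<le> \<epsilon> * real w * x d w"
          unfolding g_eq by (intro mult_right_mono x_nonneg)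
        then have "\<bar>g w\<bar> \<le> \<epsilon> * (real w * x d w)" by (simp add: mult.assoc)
        then show ?thesis using err unfolding h_def by linarith
      next
        case 3
        have "0 \<le> \<rho> * real w" "\<rho> * real w \<le> real w"
          using \<rho>_pos \<rho>_le_1 by (auto intro!: mult_left_le_one_le)
        then have "\<bar>\<rho> * real w - real_of_int d\<bar> \<le> 2 * real w" using 3(1) d by linarith
        then have "\<bar>g w\<bar> \<le> 2 * real w * x d w"
          unfolding g_eq by (intro mult_right_mono x_nonneg)
        also have "\<dots> \<le> 2 * (C * exp (- \<kappa> * real_of_int d) * q ^ w)"
          using far[OF 3] by simp
        finally show ?thesis using main by (simp add: h_def)
      qed
    qed
    have "\<rho> * v d - real_of_int d * u d \<le> \<epsilon> * v d + 2 * C * exp (- \<kappa> * real_of_int d) * (1 / (1 - q))"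
      by (rule sums_le[OF _ g h]) (use gh in \<open>auto simp: abs_le_iff\<close>)
    moreover have "- (\<rho> * v d - real_of_int d * u d) \<le> \<epsilon> * v d + 2 * C * exp (- \<kappa> * real_of_int d) * (1 / (1 - q))"
      by (rule sums_le[OF _ sums_minus[OF g] h]) (use gh in \<open>auto simp: abs_le_iff\<close>)
    ultimately show ?thesis by simp
  qed
  then show thesis
    using that[of \<kappa> "2 * C * (1 / (1 - q))"] C(2) by (simp add: mult_ac)
qed

lemma weight_degree_difference_negligible:
  "((\<lambda>d. (\<rho> * v d - real_of_int d * u d) * real_of_int d powr (1 / a)) \<longlongrightarrow> 0) at_top"
proof (rule tendstoI)
  fix \<eta> :: real assume \<eta>: "0 < \<eta>"
  let ?L = "gamma_ratio * \<rho> powr (1 / a) / a2"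
  have L: "0 < ?L"
    using \<rho>_pos by (intro divide_pos_pos[OF mult_pos_pos] gamma_ratio_pos a2_pos) simp
  define \<epsilon> where "\<epsilon> = \<eta> / (2 * ?L)"
  have "0 < \<epsilon>" unfolding \<epsilon>_def using \<eta> L by (intro divide_pos_pos) auto
  have \<epsilon>L: "\<epsilon> * ?L < \<eta>" unfolding \<epsilon>_def using \<eta> L by simp
  obtain C \<kappa> where \<kappa>: "0 < \<kappa>" and cmp: "\<And>d. 2 \<le> d \<Longrightarrow>
      \<bar>\<rho> * v d - real_of_int d * u d\<bar> \<le> \<epsilon> * v d + C * exp (- \<kappa> * real_of_int d)"
    by (rule weight_degree_comparison[OF \<open>0 < \<epsilon>\<close>]) blast
  from tendsto_add[OF tendsto_mult[OF tendsto_const[of \<epsilon>] v_asymp]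
      exp_times_powr_tendsto_0[OF \<kappa>, of C "1 / a"]]
  have "eventually (\<lambda>d. \<epsilon> * (v d * real_of_int d powr (1 / a))
      + C * exp (- \<kappa> * real_of_int d) * real_of_int d powr (1 / a) < \<eta>) at_top"
    using \<epsilon>L by (intro order_tendstoD) auto
  then show "eventually (\<lambda>d. dist ((\<rho> * v d - real_of_int d * u d) * real_of_int d powr (1 / a)) 0 < \<eta>) at_top"
    using eventually_ge_at_top[of 2]
  proof eventually_elim
    case (elim d)
    have "\<bar>\<rho> * v d - real_of_int d * u d\<bar> * real_of_int d powr (1 / a)
        \<le> (\<epsilon> * v d + C * exp (- \<kappa> * real_of_int d)) * real_of_int d powr (1 / a)"
      by (intro mult_right_mono cmp elim) simp
    with elim show ?case by (simp add: abs_mult distrib_right mult.assoc)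
  qed
qed

theorem u_asymp_equiv:
  "u \<sim>[at_top] (\<lambda>d. Gamma (1 + (b + 1) / a) / (a2 * Gamma (1 + b / a))
     * (a / a2 * real_of_int d) powr (- (1 + 1 / a)))"
proof (rule asymp_equivI')
  let ?L = "gamma_ratio * \<rho> powr (1 / a) / a2"
  have pos: "0 < \<rho> * ?L"
    using \<rho>_pos by (intro mult_pos_pos divide_pos_pos gamma_ratio_pos a2_pos) simp_all
  from tendsto_diff[OF tendsto_mult[OF tendsto_const[of \<rho>] v_asymp] weight_degree_difference_negligible]
  have "((\<lambda>d. \<rho> * (v d * real_of_int d powr (1 / a))
      - (\<rho> * v d - real_of_int d * u d) * real_of_int d powr (1 / a)) \<longlongrightarrow> \<rho> * ?L) at_top" by simp
  then have "((\<lambda>d. real_of_int d * u d * real_of_int d powr (1 / a) / (\<rho> * ?L)) \<longlongrightarrow> (\<rho> * ?L) / (\<rho> * ?L)) at_top"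
    using pos by (intro tendsto_divide) (auto simp: algebra_simps)
  then have "((\<lambda>d. real_of_int d * u d * real_of_int d powr (1 / a) / (\<rho> * ?L)) \<longlongrightarrow> 1) at_top"
    unfolding divide_self[OF less_imp_neq[OF pos, symmetric]] .
  then show "((\<lambda>d. u d / (Gamma (1 + (b + 1) / a) / (a2 * Gamma (1 + b / a))
     * (a / a2 * real_of_int d) powr (- (1 + 1 / a)))) \<longlongrightarrow> 1) at_top"
  proof (rule Lim_transform_eventually)
    show "eventually (\<lambda>d. real_of_int d * u d * real_of_int d powr (1 / a) / (\<rho> * ?L)
        = u d / (Gamma (1 + (b + 1) / a) / (a2 * Gamma (1 + b / a))
          * (a / a2 * real_of_int d) powr (- (1 + 1 / a)))) at_top"
      using eventually_ge_at_top[of 1]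
    proof eventually_elim
      case (elim d)
      have d: "0 < real_of_int d" using elim by simp
      have "(a / a2 * real_of_int d) powr (- (1 + 1 / a)) = (\<rho> / real_of_int d) powr (1 + 1 / a)"
        unfolding powr_minus \<rho>_def using d a_pos a2_pos by (simp add: powr_divide powr_mult)
      also have "\<dots> = \<rho> * \<rho> powr (1 / a) / (real_of_int d * real_of_int d powr (1 / a))"
        using d \<rho>_pos by (simp add: powr_divide powr_add)
      finally have *: "(a / a2 * real_of_int d) powr (- (1 + 1 / a))
        = \<rho> * \<rho> powr (1 / a) / (real_of_int d * real_of_int d powr (1 / a))" .
      show ?case unfolding * by (simp add: mult_ac)
    qed
  qed
qed

end

theorem theorem4p3:
  fixes p q r :: real
  assumes "0 < p" "p \<le> 1" "0 \<le> q" "q \<le> 1" "0 \<le> r" "r \<le> 1"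
    and "alpha2 p r > 0"
  shows "u_prop p q r \<sim>[at_top]
    (\<lambda>d::int. Gamma (1 + (beta p q r + 1) / alpha p q r)
        / (alpha2 p r * Gamma (1 + beta p q r / alpha p q r))
        * (alpha p q r / alpha2 p r * real_of_int d) powr (- (1 + 1 / alpha p q r)))"
proof -
  interpret degree_weight "alpha1 p q" "alpha2 p r" "beta p q r" "x_prop p q r"
  proof
    show "0 \<le> alpha1 p q" "0 < alpha2 p r" "0 \<le> beta p q r"
      using assms by (simp_all add: alpha1_def beta_def)
    show "x_prop p q r d w = 0" if "\<not> (2 \<le> d \<and> d \<le> 2 * int w)" for d w
      using that by (cases w) (simp_all only: x_prop.simps if_False)
    show "x_prop p q r 2 1 = 1 / (alpha1 p q + alpha2 p r + beta p q r + 1)"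
      by (simp add: alpha_def)
    show "x_prop p q r d (Suc w) = (alpha1 p q * real w * x_prop p q r d w
        + alpha2 p r * real w * x_prop p q r (d - 1) w + beta p q r * x_prop p q r (d - 2) w)
        / ((alpha1 p q + alpha2 p r) * real (Suc w) + beta p q r + 1)"
      if "1 \<le> w" "2 \<le> d" "d \<le> 2 * int (Suc w)" for d w
      using that by (simp add: alpha_def)
  qed
  have a_eq: "a = alpha p q r" by (simp add: a_def alpha_def)
  have "u_prop p q r d = u d" for d
  proof -
    have "(x_prop p q r d has_sum u d) UNIV"
      unfolding u_def
      by (intro sums_nonneg_imp_has_sum summable_sums summable_x x_nonneg)
    then have "(x_prop p q r d has_sum u d) {w. real w \<ge> real_of_int d / 2}"
      by (rule has_sum_cong_neutral[THEN iffD1, rotated -1]) (auto intro!: x_outside)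
    then show ?thesis unfolding u_prop_def by (rule infsumI)
  qed
  then have "u_prop p q r = u" by (rule ext)
  then show ?thesis using u_asymp_equiv by (simp only: a_eq)
qed

end
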